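(* $\tilde{\mathcal{M}}$ is weak* compact, and every extreme point of $\mathcal{M}$ belongs to $\tilde{\mathcal{M}}$, i.e. $ex(\mathcal{M})\subseteq\tilde{\mathcal{M}}$.
   Context: $L^\infty([1,\infty))$ is the space of real essentially bounded measurable functions on $[1,\infty)$, and its dual carries the weak* topology. $\mathcal{M}$ is the set of linear functionals $\psi$ on $L^\infty([1,\infty))$ with $\psi(f)\le\limsup_{x\to\infty}\frac1x\int_1^x f(t)\,dt$ for all $f$. $\tilde{\mathcal{M}}$ is the set of functionals $\psi^{\mathcal{U}}(f)=\mathcal{U}\text{-}\lim_x \frac1x\int_1^x f(t)\,dt$, where $\mathcal{U}$ ranges over ultrafilters on $[1,\infty)$ containing no bounded set, and $\mathcal{U}\text{-}\lim$ denotes the limit along the ultrafilter. $ex(\mathcal{M})$ denotes the set of extreme points of the convex set $\mathcal{M}$. *)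

theory Defs
  imports "HOL-Analysis.Analysis" "HOL-Probability.Essential_Supremum"
begin

section \<open>The normed space \<open>L\<^sup>\<infinity>([1,\<infinity>))\<close>\<close>

abbreviation leb1 :: "real measure"
  where "leb1 \<equiv> lebesgue_on {1..}"

definition ess_bounded :: "(real \<Rightarrow> real) \<Rightarrow> bool"
  where "ess_bounded f \<longleftrightarrow> f \<in> borel_measurable leb1 \<and> (\<exists>C. AE x in leb1. \<bar>f x\<bar> \<le> C)"

definition linfty_rel :: "(real \<Rightarrow> real) \<Rightarrow> (real \<Rightarrow> real) \<Rightarrow> bool"
  where "linfty_rel f g \<longleftrightarrow> ess_bounded f \<and> ess_bounded g \<and> (AE x in leb1. f x = g x)"

lemma ess_bounded_0: "ess_bounded (\<lambda>x. 0)"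
  unfolding ess_bounded_def by auto

lemma ess_bounded_add:
  assumes "ess_bounded f" "ess_bounded g" shows "ess_bounded (\<lambda>x. f x + g x)"
proof -
  obtain C D where "AE x in leb1. \<bar>f x\<bar> \<le> C" "AE x in leb1. \<bar>g x\<bar> \<le> D"
    using assms unfolding ess_bounded_def by auto
  then have "AE x in leb1. \<bar>f x + g x\<bar> \<le> C + D"
    by eventually_elim linarith
  with assms show ?thesis
    unfolding ess_bounded_def by auto
qed

lemma ess_bounded_scale:
  assumes "ess_bounded f" shows "ess_bounded (\<lambda>x. c * f x)"
proof -
  obtain C where "AE x in leb1. \<bar>f x\<bar> \<le> C"
    using assms unfolding ess_bounded_def by auto
  then have "AE x in leb1. \<bar>c * f x\<bar> \<le> \<bar>c\<bar> * C"
    by eventually_elim (simp add: abs_mult mult_left_mono)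
  with assms show ?thesis
    unfolding ess_bounded_def by auto
qed

lemma ess_bounded_minus: "ess_bounded f \<Longrightarrow> ess_bounded (\<lambda>x. - f x)"
  using ess_bounded_scale[of f "-1"] by simp

quotient_type linfty = "real \<Rightarrow> real" / partial: linfty_rel
proof (rule part_equivpI)
  show "\<exists>f. linfty_rel f f"
    using ess_bounded_0 unfolding linfty_rel_def by auto
  show "symp linfty_rel"
    by (rule sympI) (auto simp: linfty_rel_def eq_commute)
  show "transp linfty_rel"
    by (rule transpI) (auto simp: linfty_rel_def elim: eventually_elim2)
qed

subsection \<open>The essential supremum norm\<close>

definition linfty_norm :: "(real \<Rightarrow> real) \<Rightarrow> real"
  where "linfty_norm f = real_of_ereal (esssup leb1 (\<lambda>x. ereal \<bar>f x\<bar>))"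

lemma leb1_nontrivial: "emeasure leb1 (space leb1) \<noteq> 0"
proof
  assume "emeasure leb1 (space leb1) = 0"
  then have "emeasure lebesgue {1..(2::real)} \<le> 0"
    using emeasure_mono[of "{1..2::real}" "{1..}" lebesgue]
    by (simp add: emeasure_restrict_space)
  then show False by simp
qed

lemma esssup_eq_linfty_norm:
  assumes "ess_bounded f"
  shows "esssup leb1 (\<lambda>x. ereal \<bar>f x\<bar>) = ereal (linfty_norm f)" "0 \<le> linfty_norm f"
proof -
  have m: "(\<lambda>x. ereal \<bar>f x\<bar>) \<in> borel_measurable leb1"
    using assms unfolding ess_bounded_def by auto
  obtain C where C: "AE x in leb1. \<bar>f x\<bar> \<le> C"
    using assms unfolding ess_bounded_def by auto
  have up: "esssup leb1 (\<lambda>x. ereal \<bar>f x\<bar>) \<le> ereal C"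
    using C by (intro esssup_I[OF m]) simp
  have "esssup leb1 (\<lambda>x. 0::ereal) \<le> esssup leb1 (\<lambda>x. ereal \<bar>f x\<bar>)"
    by (rule esssup_mono) auto
  then have lo: "0 \<le> esssup leb1 (\<lambda>x. ereal \<bar>f x\<bar>)"
    by (simp add: esssup_const[OF leb1_nontrivial])
  show "esssup leb1 (\<lambda>x. ereal \<bar>f x\<bar>) = ereal (linfty_norm f)" "0 \<le> linfty_norm f"
    using up lo unfolding linfty_norm_def
    by (cases "esssup leb1 (\<lambda>x. ereal \<bar>f x\<bar>)"; simp)+
qed

lemma linfty_norm_AE:
  assumes "ess_bounded f" shows "AE x in leb1. \<bar>f x\<bar> \<le> linfty_norm f"
  using esssup_AE[of "\<lambda>x. ereal \<bar>f x\<bar>" leb1] esssup_eq_linfty_norm(1)[OF assms] by simp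

lemma linfty_norm_le:
  assumes "ess_bounded f" "AE x in leb1. \<bar>f x\<bar> \<le> C" shows "linfty_norm f \<le> C"
proof -
  have "(\<lambda>x. ereal \<bar>f x\<bar>) \<in> borel_measurable leb1"
    using assms unfolding ess_bounded_def by auto
  then have "esssup leb1 (\<lambda>x. ereal \<bar>f x\<bar>) \<le> ereal C"
    using assms(2) by (intro esssup_I) auto
  then show ?thesis
    using esssup_eq_linfty_norm(1)[OF assms(1)] by simp
qed

lemma linfty_norm_cong:
  assumes "linfty_rel f g" shows "linfty_norm f = linfty_norm g"
proof (rule antisym)
  have r: "ess_bounded f" "ess_bounded g" "AE x in leb1. f x = g x"
    using assms unfolding linfty_rel_def by auto
  show "linfty_norm f \<le> linfty_norm g"
    using r(3) linfty_norm_AE[OF r(2)]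
    by (intro linfty_norm_le[OF r(1)]) (auto elim: eventually_elim2)
  show "linfty_norm g \<le> linfty_norm f"
    using r(3) linfty_norm_AE[OF r(1)]
    by (intro linfty_norm_le[OF r(2)]) (auto elim: eventually_elim2)
qed

lemma linfty_norm_scale_le:
  assumes "ess_bounded f" shows "linfty_norm (\<lambda>x. c * f x) \<le> \<bar>c\<bar> * linfty_norm f"
  using linfty_norm_AE[OF assms]
  by (intro linfty_norm_le ess_bounded_scale[OF assms])
    (auto elim!: eventually_mono simp: abs_mult mult_left_mono)

instantiation linfty :: real_normed_vector
begin

lift_definition zero_linfty :: linfty is "\<lambda>x. 0"
  by (auto simp: linfty_rel_def ess_bounded_0)

lift_definition plus_linfty :: "linfty \<Rightarrow> linfty \<Rightarrow> linfty" is "\<lambda>f g x. f x + g x"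
  by (auto simp: linfty_rel_def intro: ess_bounded_add elim: eventually_elim2)

lift_definition uminus_linfty :: "linfty \<Rightarrow> linfty" is "\<lambda>f x. - f x"
  by (auto simp: linfty_rel_def intro: ess_bounded_minus)

lift_definition minus_linfty :: "linfty \<Rightarrow> linfty \<Rightarrow> linfty" is "\<lambda>f g x. f x - g x"
  using ess_bounded_add[OF _ ess_bounded_minus]
  by (auto simp: linfty_rel_def elim: eventually_elim2)

lift_definition scaleR_linfty :: "real \<Rightarrow> linfty \<Rightarrow> linfty" is "\<lambda>c f x. c * f x"
  by (auto simp: linfty_rel_def intro: ess_bounded_scale)

lift_definition norm_linfty :: "linfty \<Rightarrow> real" is linfty_norm
  by (rule linfty_norm_cong)

definition dist_linfty :: "linfty \<Rightarrow> linfty \<Rightarrow> real"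
  where "dist_linfty f g = norm (f - g)"

definition sgn_linfty :: "linfty \<Rightarrow> linfty"
  where "sgn_linfty f = inverse (norm f) *\<^sub>R f"

definition uniformity_linfty :: "(linfty \<times> linfty) filter"
  where "uniformity_linfty = (INF e\<in>{0<..}. principal {(f, g). dist f g < e})"

definition open_linfty :: "linfty set \<Rightarrow> bool"
  where "open_linfty U \<longleftrightarrow> (\<forall>f\<in>U. eventually (\<lambda>(f', g). f' = f \<longrightarrow> g \<in> U) uniformity)"

instance
proof
  fix f g h :: linfty and a b :: real
  show "f + g + h = f + (g + h)"
    by transfer (auto simp: linfty_rel_def add.assoc intro!: ess_bounded_add)
  show "f + g = g + f"
    by transfer (auto simp: linfty_rel_def add.commute intro!: ess_bounded_add)
  show "0 + f = f"
    by transfer (auto simp: linfty_rel_def)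
  show "- f + f = 0"
    by transfer (auto simp: linfty_rel_def ess_bounded_0)
  show "f - g = f + - g"
    by transfer (auto simp: linfty_rel_def intro!: ess_bounded_add[OF _ ess_bounded_minus, simplified])
  show "a *\<^sub>R (f + g) = a *\<^sub>R f + a *\<^sub>R g"
    by transfer (auto simp: linfty_rel_def distrib_left
        intro!: ess_bounded_add[OF ess_bounded_scale ess_bounded_scale])
  show "(a + b) *\<^sub>R f = a *\<^sub>R f + b *\<^sub>R f"
    by transfer (auto simp: linfty_rel_def distrib_right
        intro!: ess_bounded_add[OF ess_bounded_scale ess_bounded_scale])
  show "a *\<^sub>R b *\<^sub>R f = (a * b) *\<^sub>R f"
    by transfer (auto simp: linfty_rel_def mult.assoc intro!: ess_bounded_scale)
  show "1 *\<^sub>R f = f"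
    by transfer (auto simp: linfty_rel_def)
  show "dist f g = norm (f - g)"
    by (rule dist_linfty_def)
  show "sgn f = inverse (norm f) *\<^sub>R f"
    by (rule sgn_linfty_def)
  show "uniformity = (INF e\<in>{0<..}. principal {(f, g :: linfty). dist f g < e})"
    by (rule uniformity_linfty_def)
  show "open U \<longleftrightarrow> (\<forall>f\<in>U. eventually (\<lambda>(f', g). f' = f \<longrightarrow> g \<in> U) uniformity)"
    for U :: "linfty set"
    by (rule open_linfty_def)
  show "norm f = 0 \<longleftrightarrow> f = 0"
  proof transfer
    fix f assume "linfty_rel f f"
    then have f: "ess_bounded f" by (simp add: linfty_rel_def)
    have "AE x in leb1. f x = 0" if "linfty_norm f = 0"
      using linfty_norm_AE[OF f] that by simp
    moreover have "linfty_norm f = 0" if "AE x in leb1. f x = 0"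
      using linfty_norm_le[OF f, of 0] esssup_eq_linfty_norm(2)[OF f] that by simp
    ultimately show "linfty_norm f = 0 \<longleftrightarrow> linfty_rel f (\<lambda>x. 0)"
      using f ess_bounded_0 unfolding linfty_rel_def by blast
  qed
  show "norm (f + g) \<le> norm f + norm g"
  proof transfer
    fix f g assume "linfty_rel f f" "linfty_rel g g"
    then have fg: "ess_bounded f" "ess_bounded g" by (simp_all add: linfty_rel_def)
    show "linfty_norm (\<lambda>x. f x + g x) \<le> linfty_norm f + linfty_norm g"
    proof (rule linfty_norm_le[OF ess_bounded_add[OF fg]])
      show "AE x in leb1. \<bar>f x + g x\<bar> \<le> linfty_norm f + linfty_norm g"
        using linfty_norm_AE[OF fg(1)] linfty_norm_AE[OF fg(2)]
        by eventually_elim linarith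
    qed
  qed
  show "norm (a *\<^sub>R f) = \<bar>a\<bar> * norm f"
  proof transfer
    fix c :: real and f assume "linfty_rel f f"
    then have f: "ess_bounded f" by (simp add: linfty_rel_def)
    show "linfty_norm (\<lambda>x. c * f x) = \<bar>c\<bar> * linfty_norm f"
    proof (cases "c = 0")
      case True
      then show ?thesis
        using linfty_norm_le[OF ess_bounded_0, of 0] esssup_eq_linfty_norm(2)[OF ess_bounded_0]
        by simp
    next
      case False
      have "linfty_norm f \<le> \<bar>inverse c\<bar> * linfty_norm (\<lambda>x. c * f x)"
        using linfty_norm_scale_le[OF ess_bounded_scale[OF f], of "inverse c" c] False
        by (simp add: mult.assoc[symmetric])
      then have "\<bar>c\<bar> * linfty_norm f \<le> linfty_norm (\<lambda>x. c * f x)"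
        using False by (simp add: field_simps abs_inverse)
      with linfty_norm_scale_le[OF f] show ?thesis by (intro antisym)
    qed
  qed
qed

end

section \<open>Averages and the sets of functionals\<close>

lemma set_lebesgue_integral_leb1:
  fixes h :: "real \<Rightarrow> real"
  shows "(LINT t:{1..x}|lebesgue. h t) = integral\<^sup>L leb1 (\<lambda>t. indicator {1..x} t * h t)"
  by (simp add: integral_restrict_space set_lebesgue_integral_def)
     (auto intro!: Bochner_Integration.integral_cong simp: indicator_def)

lemma indicator_leb1:
  shows indicator_integrable: "integrable leb1 (indicator {1..x} :: real \<Rightarrow> real)"
    and indicator_integral: "1 \<le> x \<Longrightarrow> integral\<^sup>L leb1 (indicator {1..x} :: real \<Rightarrow> real) = x - 1"
proof -
  have s: "{1..x} \<in> sets leb1"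
    by (simp add: sets_restrict_space_iff)
  have e: "emeasure leb1 {1..x} = emeasure lborel {1..x}"
    by (simp add: emeasure_restrict_space)
  then have "emeasure leb1 {1..x} < \<infinity>"
    by (simp add: emeasure_lborel_Icc_eq)
  with s show "integrable leb1 (indicator {1..x} :: real \<Rightarrow> real)"
    by (intro integrable_real_indicator)
  show "integral\<^sup>L leb1 (indicator {1..x} :: real \<Rightarrow> real) = x - 1" if "1 \<le> x"
    using s that e by (simp add: measure_def Int_absorb2)
qed

lemma ess_bounded_integrable:
  assumes "ess_bounded f"
  shows "integrable leb1 (\<lambda>t. indicator {1..x} t * f t)"
proof -
  have m: "f \<in> borel_measurable leb1" "(indicator {1..x} :: real \<Rightarrow> real) \<in> borel_measurable leb1"
    using assms borel_measurable_integrable[OF indicator_integrable] by (auto simp: ess_bounded_def)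
  show ?thesis
  proof (rule Bochner_Integration.integrable_bound)
    show "integrable leb1 (\<lambda>t. linfty_norm f * indicator {1..x} t)"
      by (intro integrable_mult_right indicator_integrable)
    show "(\<lambda>t. indicator {1..x} t * f t) \<in> borel_measurable leb1"
      using m by measurable
    show "AE t in leb1. norm (indicator {1..x} t * f t) \<le> norm (linfty_norm f * indicator {1..x} t)"
      using linfty_norm_AE[OF assms]
      by eventually_elim (auto simp: indicator_def)
  qed
qed

text \<open>The integral is taken against Lebesgue measure, not \<^const>\<open>lborel\<close>, because
  representatives are only assumed to be Lebesgue measurable.\<close>

lift_definition average :: "linfty \<Rightarrow> real \<Rightarrow> real"
  is "\<lambda>f x. (1 / x) * (LINT t:{1..x}|lebesgue. f t)"
proof -
  fix f g assume r: "linfty_rel f g"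
  have i: "(LINT t:{1..x}|lebesgue. f t) = (LINT t:{1..x}|lebesgue. g t)" for x
  proof -
    have "f \<in> borel_measurable leb1" "g \<in> borel_measurable leb1"
      using r by (auto simp: linfty_rel_def ess_bounded_def)
    moreover have "(indicator {1..x} :: real \<Rightarrow> real) \<in> borel_measurable leb1"
      by (intro measurable_restrict_space1 borel_measurable_indicator) simp
    ultimately show ?thesis unfolding set_lebesgue_integral_leb1
      using r by (intro integral_cong_AE) (auto simp: linfty_rel_def)
  qed
  show "(\<lambda>x. (1 / x) * (LINT t:{1..x}|lebesgue. f t)) = (\<lambda>x. (1 / x) * (LINT t:{1..x}|lebesgue. g t))"
    by (simp only: i)
qed

lemma average_add: "average (f + g) x = average f x + average g x"
proof transfer
  fix f g x assume "linfty_rel f f" "linfty_rel g g"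
  then have "ess_bounded f" "ess_bounded g"
    by (simp_all add: linfty_rel_def)
  note int = this[THEN ess_bounded_integrable, of x]
  show "1 / x * (LINT t:{1..x}|lebesgue. f t + g t) =
      1 / x * (LINT t:{1..x}|lebesgue. f t) + 1 / x * (LINT t:{1..x}|lebesgue. g t)"
    unfolding set_lebesgue_integral_leb1 distrib_left
      Bochner_Integration.integral_add[OF int] by (rule refl)
qed

lemma average_scaleR: "average (c *\<^sub>R f) x = c * average f x"
  by transfer simp

lemma abs_average_le:
  assumes "1 \<le> x" shows "\<bar>average f x\<bar> \<le> norm f"
  using assms
proof transfer
  fix x :: real and f assume x: "1 \<le> x" and "linfty_rel f f"
  then have f: "ess_bounded f" by (simp add: linfty_rel_def)
  note int = ess_bounded_integrable[OF f, of x]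
  have "\<bar>integral\<^sup>L leb1 (\<lambda>t. indicator {1..x} t * f t)\<bar>
      \<le> integral\<^sup>L leb1 (\<lambda>t. \<bar>indicator {1..x} t * f t\<bar>)"
    by (rule integral_abs_bound)
  also have "\<dots> \<le> integral\<^sup>L leb1 (\<lambda>t. linfty_norm f * indicator {1..x} t)"
  proof (rule integral_mono_AE)
    show "integrable leb1 (\<lambda>t. \<bar>indicator {1..x} t * f t\<bar>)"
      using int by (rule integrable_abs)
    show "integrable leb1 (\<lambda>t. linfty_norm f * indicator {1..x} t)"
      by (intro integrable_mult_right indicator_integrable)
    show "AE t in leb1. \<bar>indicator {1..x} t * f t\<bar> \<le> linfty_norm f * indicator {1..x} t"
      using linfty_norm_AE[OF f] by eventually_elim (auto simp: indicator_def)
  qed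
  also have "\<dots> = linfty_norm f * (x - 1)"
    using indicator_integral[OF x] by (simp only: integral_mult_right_zero)
  also have "\<dots> \<le> linfty_norm f * x"
    using esssup_eq_linfty_norm(2)[OF f] by (simp add: mult_left_mono)
  finally show "\<bar>1 / x * (LINT t:{1..x}|lebesgue. f t)\<bar> \<le> linfty_norm f"
    using x unfolding set_lebesgue_integral_leb1 by (simp add: field_simps abs_mult)
qed

text \<open>The strong operator topology on the operators into the scalars is the topology of pointwise
  convergence on the dual, i.e. the weak* topology.\<close>

abbreviation weak_star_topology :: "('a::real_normed_vector \<Rightarrow>\<^sub>L real) topology"
  where "weak_star_topology \<equiv> strong_operator_topology"

text \<open>The limsup is extended-real valued, as \<^const>\<open>Limsup\<close> needs a complete lattice.
  Continuity of the functionals is no restriction: see \<open>bounded_linear_if_le_Limsup_average\<close>.\<close>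

definition calM :: "(linfty \<Rightarrow>\<^sub>L real) set"
  where "calM = {\<psi>. \<forall>f. ereal (blinfun_apply \<psi> f) \<le> Limsup at_top (\<lambda>x. ereal (average f x))}"

lemma bounded_linear_if_le_Limsup_average:
  assumes "linear \<psi>" and le: "\<And>f. ereal (\<psi> f) \<le> Limsup at_top (\<lambda>x. ereal (average f x))"
  shows "bounded_linear \<psi>"
proof -
  have b: "\<psi> f \<le> norm f" for f
  proof -
    have "Limsup at_top (\<lambda>x. ereal (average f x)) \<le> ereal (norm f)"
    proof (rule Limsup_bounded)
      show "\<forall>\<^sub>F x in at_top. ereal (average f x) \<le> ereal (norm f)"
        using eventually_ge_at_top[of 1]
        by eventually_elim (use abs_average_le in \<open>fastforce simp: abs_le_iff\<close>)
    qed
    with le[of f] show ?thesis by (metis ereal_less_eq(3) order_trans)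
  qed
  have "\<bar>\<psi> f\<bar> \<le> norm f" for f
    using b[of f] b[of "- f"] linear_neg[OF assms(1), of f] by (simp add: abs_le_iff)
  then show ?thesis
    using assms(1) by (intro bounded_linear_intro[of _ 1]) (auto simp: linear_add linear_cmul)
qed

text \<open>Ultrafilters on a set \<open>X\<close> are represented by filters on the ambient type that contain \<open>X\<close>;
  their members are the sets \<open>A\<close> with \<open>eventually (\<lambda>x. x \<in> A) U\<close>.\<close>

definition ultrafilter_on :: "'a set \<Rightarrow> 'a filter \<Rightarrow> bool"
  where "ultrafilter_on X U \<longleftrightarrow> U \<noteq> bot \<and> eventually (\<lambda>x. x \<in> X) U \<and>
    (\<forall>A\<subseteq>X. eventually (\<lambda>x. x \<in> A) U \<or> eventually (\<lambda>x. x \<in> X - A) U)"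

definition free_at_infinity :: "real filter \<Rightarrow> bool"
  where "free_at_infinity U \<longleftrightarrow> (\<forall>A\<subseteq>{1..}. bounded A \<longrightarrow> \<not> eventually (\<lambda>x. x \<in> A) U)"

definition calM_tilde :: "(linfty \<Rightarrow>\<^sub>L real) set"
  where "calM_tilde = {\<psi>. \<exists>U. ultrafilter_on {1..} U \<and> free_at_infinity U \<and>
    (\<forall>f. (average f \<longlongrightarrow> blinfun_apply \<psi> f) U)}"

text \<open>Every ultrafilter does induce a functional, so the membership condition in
  \<^const>\<open>calM_tilde\<close> discards no ultrafilter.\<close>

lemma ultrafilter_limit_exists:
  fixes h :: "'a \<Rightarrow> real"
  assumes U: "ultrafilter_on X U" and b: "\<And>x. x \<in> X \<Longrightarrow> \<bar>h x\<bar> \<le> C"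
  shows "\<exists>l. (h \<longlongrightarrow> l) U"
proof -
  have X: "eventually (\<lambda>x. x \<in> X) U" and ne: "U \<noteq> bot"
    using U unfolding ultrafilter_on_def by auto
  have "eventually (\<lambda>x. h x \<in> {-C..C}) U"
    using X by eventually_elim (use b in \<open>fastforce simp: abs_le_iff\<close>)
  then have "eventually (\<lambda>y. y \<in> {-C..C}) (filtermap h U)"
    by (simp add: eventually_filtermap)
  moreover have "filtermap h U \<noteq> bot"
    using ne by (simp add: filtermap_bot_iff)
  ultimately obtain l where l: "inf (nhds l) (filtermap h U) \<noteq> bot"
    using compact_Icc[of "-C" C] unfolding compact_filter by blast
  have "(h \<longlongrightarrow> l) U"
  proof (rule topological_tendstoI)
    fix S assume S: "open S" "l \<in> S"
    let ?A = "{x \<in> X. h x \<in> S}"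
    have "\<not> eventually (\<lambda>x. x \<in> X - ?A) U"
    proof
      assume "eventually (\<lambda>x. x \<in> X - ?A) U"
      then have "eventually (\<lambda>y. y \<notin> S) (filtermap h U)"
        unfolding eventually_filtermap by eventually_elim auto
      moreover have "eventually (\<lambda>y. y \<in> S) (nhds l)"
        using S by (rule eventually_nhds_in_open)
      ultimately have "eventually (\<lambda>y. False) (inf (nhds l) (filtermap h U))"
        unfolding eventually_inf by blast
      with l show False by (simp add: trivial_limit_def)
    qed
    moreover have "?A \<subseteq> X" by auto
    ultimately have "eventually (\<lambda>x. x \<in> ?A) U"
      using U unfolding ultrafilter_on_def by metis
    then show "eventually (\<lambda>x. h x \<in> S) U"
      by eventually_elim simp
  qed
  then show ?thesis ..
qed

lemma ultrafilter_functional_exists: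
  assumes U: "ultrafilter_on {1..} U"
  shows "\<exists>!\<psi>. \<forall>f. (average f \<longlongrightarrow> blinfun_apply \<psi> f) U"
proof -
  have ne: "U \<noteq> bot" and ev: "eventually (\<lambda>x. x \<in> {1..}) U"
    using U unfolding ultrafilter_on_def by auto
  have "\<exists>l. (average f \<longlongrightarrow> l) U" for f
    using U by (rule ultrafilter_limit_exists[where C = "norm f"]) (simp add: abs_average_le)
  then obtain p where p: "\<And>f. (average f \<longlongrightarrow> p f) U" by metis
  have "bounded_linear p"
  proof (rule bounded_linear_intro[of _ 1])
    fix f g
    have "(average (f + g) \<longlongrightarrow> p f + p g) U"
      using tendsto_add[OF p[of f] p[of g]] by (simp add: average_add[abs_def])
    then show "p (f + g) = p f + p g"
      using p ne tendsto_unique by blast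
  next
    fix c f
    have "(average (c *\<^sub>R f) \<longlongrightarrow> c * p f) U"
      using tendsto_mult[OF tendsto_const[of c] p[of f]] by (simp add: average_scaleR[abs_def])
    then show "p (c *\<^sub>R f) = c *\<^sub>R p f"
      using p ne tendsto_unique by (metis real_scaleR_def)
  next
    fix f
    have "eventually (\<lambda>x. norm (average f x) \<le> norm f) U"
      using ev by eventually_elim (simp add: abs_average_le)
    then show "norm (p f) \<le> norm f * 1"
      using Lim_norm_ubound[OF ne p[of f]] by simp
  qed
  then have ex: "\<forall>f. (average f \<longlongrightarrow> blinfun_apply (Blinfun p) f) U"
    using p by (simp add: bounded_linear_Blinfun_apply)
  show ?thesis
  proof (rule ex1I)
    show "\<forall>f. (average f \<longlongrightarrow> blinfun_apply (Blinfun p) f) U" by (rule ex)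
  next
    fix \<psi> assume "\<forall>f. (average f \<longlongrightarrow> blinfun_apply \<psi> f) U"
    with ex show "\<psi> = Blinfun p"
      using ne tendsto_unique by (intro blinfun_eqI) blast
  qed
qed

end

(* An extreme point psi of M is dominated by the upper limit of averages along at_top; by Zorn choose
   a minimal filter U below at_top along which this still holds. For every set A, Hahn-Banach writes
   psi as a convex combination of functionals dominated along the two parts of U inside and outside A,
   so by extremality psi is dominated along one part, and by minimality U is contained in it. Hence U
   is an ultrafilter, upper limits along U are limits, and psi is the limit along U.

   Seen as functions on L^infinity, the members of M-tilde are exactly the cluster points, as x tends
   to infinity, of the evaluations f -> (average of f up to x). These form a closed subset of a
   product of compact intervals. *)

theory Submission
  imports Defs
begin

section \<open>Minimal elements and the Hahn--Banach theorem\<close>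

lemma minimal_element_exists:
  fixes S :: "'a::order set"
  assumes "\<And>C. C \<subseteq> S \<Longrightarrow> (\<And>x y. x \<in> C \<Longrightarrow> y \<in> C \<Longrightarrow> x \<le> y \<or> y \<le> x) \<Longrightarrow>
    \<exists>u\<in>S. \<forall>x\<in>C. u \<le> x"
  shows "\<exists>m\<in>S. \<forall>x\<in>S. x \<le> m \<longrightarrow> x = m"
proof (rule predicate_Zorn)
  show "partial_order_on S (relation_of (\<lambda>x y. y \<le> x) S)"
    by (rule partial_order_on_relation_ofI) auto
  show "\<exists>u\<in>S. \<forall>a\<in>C. u \<le> a" if "C \<in> Chains (relation_of (\<lambda>x y. y \<le> x) S)" for C
    using that by (intro assms) (auto simp: Chains_def relation_of_def)
qed

definition sublinear :: "('a::real_vector \<Rightarrow> real) \<Rightarrow> bool"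
  where "sublinear p \<longleftrightarrow> (\<forall>x y. p (x + y) \<le> p x + p y) \<and> (\<forall>c x. 0 \<le> c \<longrightarrow> p (c *\<^sub>R x) = c * p x)"

lemma sublinear_add: "sublinear p \<Longrightarrow> p (x + y) \<le> p x + p y"
  by (simp add: sublinear_def)

lemma sublinear_scale: "sublinear p \<Longrightarrow> 0 \<le> c \<Longrightarrow> p (c *\<^sub>R x) = c * p x"
  by (simp add: sublinear_def)

lemma sublinear_zero: "sublinear p \<Longrightarrow> p 0 = 0"
  using sublinear_scale[of p 0 0] by simp

lemma sublinear_lower: "sublinear p \<Longrightarrow> - p (- x) \<le> p x"
  using sublinear_add[of p x "- x"] sublinear_zero[of p] by simp

lemma sublinearI:
  fixes p :: "'a::real_vector \<Rightarrow> real"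
  assumes add: "\<And>x y. p (x + y) \<le> p x + p y"
    and le: "\<And>c x. 0 < c \<Longrightarrow> p (c *\<^sub>R x) \<le> c * p x" and zero: "p 0 = 0"
  shows "sublinear p"
  unfolding sublinear_def
proof (intro conjI allI impI add)
  fix c x assume "(0::real) \<le> c"
  show "p (c *\<^sub>R x) = c * p x"
  proof (cases "c = 0")
    case False
    with \<open>0 \<le> c\<close> have c: "0 < c" by simp
    have "p (inverse c *\<^sub>R c *\<^sub>R x) \<le> inverse c * p (c *\<^sub>R x)"
      using c by (intro le) simp
    then have "c * p x \<le> p (c *\<^sub>R x)"
      using c by (simp add: field_simps)
    with le[OF c, of x] show ?thesis by simp
  qed (simp add: zero)
qed

lemma sublinear_inf_cone:
  fixes p :: "'a::real_vector \<Rightarrow> real"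
  assumes p: "sublinear p" and zero: "(0, 0) \<in> D"
    and D_add: "\<And>z w. z \<in> D \<Longrightarrow> w \<in> D \<Longrightarrow> z + w \<in> D"
    and D_scale: "\<And>c z. 0 < c \<Longrightarrow> z \<in> D \<Longrightarrow> c *\<^sub>R z \<in> D"
    and le: "\<And>v r. (v, r) \<in> D \<Longrightarrow> r \<le> p v"
  obtains q where "sublinear q" "\<And>x v r. (v, r) \<in> D \<Longrightarrow> q x \<le> p (x + v) - r"
proof -
  define q where "q x = (INF z\<in>D. p (x + fst z) - snd z)" for x
  have bdd: "bdd_below ((\<lambda>z. p (x + fst z) - snd z) ` D)" for x
  proof (rule bdd_belowI2)
    fix z assume "z \<in> D"
    then show "- p (- x) \<le> p (x + fst z) - snd z"
      using le[of "fst z" "snd z"] sublinear_add[OF p, of "x + fst z" "- x"] by simp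
  qed
  have upper: "q x \<le> p (x + fst z) - snd z" if "z \<in> D" for x z
    unfolding q_def using that by (intro cINF_lower bdd)
  have lower: "c \<le> q x" if "\<And>z. z \<in> D \<Longrightarrow> c \<le> p (x + fst z) - snd z" for x c
    unfolding q_def using zero that by (intro cINF_greatest) auto
  have "sublinear q"
  proof (rule sublinearI)
    fix x y
    have "q (x + y) - (p (y + fst w) - snd w) \<le> p (x + fst z) - snd z" if "z \<in> D" "w \<in> D" for z w
      using upper[OF D_add[OF that], of "x + y"]
        sublinear_add[OF p, of "x + fst z" "y + fst w"] by (simp add: algebra_simps)
    then have "q (x + y) - (p (y + fst w) - snd w) \<le> q x" if "w \<in> D" for w
      using that by (intro lower)
    then have "q (x + y) - q x \<le> q y"
      by (intro lower) (simp add: algebra_simps)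
    then show "q (x + y) \<le> q x + q y" by simp
  next
    fix c x assume c: "(0::real) < c"
    have "q (c *\<^sub>R x) / c \<le> p (x + fst z) - snd z" if "z \<in> D" for z
    proof -
      have "q (c *\<^sub>R x) \<le> c * (p (x + fst z) - snd z)"
        using upper[OF D_scale[OF c that], of "c *\<^sub>R x"] c
          sublinear_scale[OF p, of c "x + fst z"] by (simp add: algebra_simps)
      with c show ?thesis by (simp add: field_simps)
    qed
    then have "q (c *\<^sub>R x) / c \<le> q x" by (rule lower)
    with c show "q (c *\<^sub>R x) \<le> c * q x" by (simp add: field_simps)
  next
    show "q 0 = 0"
      using upper[OF zero, of 0] lower[of 0 0] le sublinear_zero[OF p] by (intro antisym) auto
  qed
  moreover have "q x \<le> p (x + v) - r" if "(v, r) \<in> D" for x v r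
    using upper[OF that] by simp
  ultimately show thesis by (rule that)
qed

lemma sublinear_INF_chain:
  fixes C :: "('a::real_vector \<Rightarrow> real) set"
  assumes sub: "\<And>p. p \<in> C \<Longrightarrow> sublinear p" and ne: "C \<noteq> {}"
    and chain: "\<And>p q. p \<in> C \<Longrightarrow> q \<in> C \<Longrightarrow> p \<le> q \<or> q \<le> p"
  obtains u where "sublinear u" "\<And>p. p \<in> C \<Longrightarrow> u \<le> p"
proof -
  obtain p0 where p0: "p0 \<in> C" using ne by auto
  define u where "u x = (INF p\<in>C. p x)" for x
  have bdd: "bdd_below ((\<lambda>p. p x) ` C)" for x
  proof (rule bdd_belowI2)
    fix p assume p: "p \<in> C"
    show "min (- p0 (- x)) (p0 x) \<le> p x"
      using chain[OF p p0] sublinear_lower[OF sub[OF p], of x] by (auto simp: le_fun_def min_le_iff_disj intro: order_trans dest: spec[of _ "- x"])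
  qed
  have upper: "u x \<le> p x" if "p \<in> C" for p x
    unfolding u_def using that by (intro cINF_lower bdd)
  have lower: "c \<le> u x" if "\<And>p. p \<in> C \<Longrightarrow> c \<le> p x" for x c
    unfolding u_def using ne that by (intro cINF_greatest)
  have "sublinear u"
  proof (rule sublinearI)
    fix x y
    have "u (x + y) - q y \<le> p x" if pq: "p \<in> C" "q \<in> C" for p q
    proof -
      obtain r where r: "r \<in> C" "r \<le> p" "r \<le> q"
        using chain[OF pq] pq by auto
      then show ?thesis
        using upper[OF r(1), of "x + y"] sublinear_add[OF sub[OF r(1)], of x y]
        by (simp add: le_fun_def) (smt (verit))
    qed
    then have "u (x + y) - q y \<le> u x" if "q \<in> C" for q
      using that by (intro lower)
    then have "u (x + y) - u x \<le> u y"
      by (intro lower) (simp add: algebra_simps)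
    then show "u (x + y) \<le> u x + u y" by simp
  next
    fix c x assume c: "(0::real) < c"
    have "u (c *\<^sub>R x) / c \<le> p x" if "p \<in> C" for p
      using upper[OF that, of "c *\<^sub>R x"] sublinear_scale[OF sub[OF that], of c x] c
      by (simp add: field_simps)
    then have "u (c *\<^sub>R x) / c \<le> u x" by (rule lower)
    with c show "u (c *\<^sub>R x) \<le> c * u x" by (simp add: field_simps)
  next
    show "u 0 = 0"
    proof (rule antisym)
      show "u 0 \<le> 0"
        using upper[OF p0, of 0] sublinear_zero[OF sub[OF p0]] by simp
      show "0 \<le> u 0"
        by (rule lower) (use sublinear_zero[OF sub] in force)
    qed
  qed
  then show thesis
    by (rule that) (simp add: le_fun_def upper)
qed

lemma linear_minorant_exists:
  fixes p :: "'a::real_vector \<Rightarrow> real"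
  assumes p: "sublinear p"
  obtains g where "linear g" "\<And>x. g x \<le> p x"
proof -
  have "\<exists>m\<in>{q. sublinear q \<and> q \<le> p}. \<forall>q\<in>{q. sublinear q \<and> q \<le> p}. q \<le> m \<longrightarrow> q = m"
  proof (rule minimal_element_exists)
    fix C assume C: "C \<subseteq> {q. sublinear q \<and> q \<le> p}"
      and chain: "\<And>x y. x \<in> C \<Longrightarrow> y \<in> C \<Longrightarrow> x \<le> y \<or> y \<le> x"
    show "\<exists>u\<in>{q. sublinear q \<and> q \<le> p}. \<forall>x\<in>C. u \<le> x"
    proof (cases "C = {}")
      case False
      then obtain u where "sublinear u" "\<And>q. q \<in> C \<Longrightarrow> u \<le> q"
        using sublinear_INF_chain[of C] C chain by blast
      with C False show ?thesis by (blast intro: order_trans)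
    qed (use p in auto)
  qed
  then obtain m where m: "sublinear m" "m \<le> p"
    and min: "\<And>q. sublinear q \<Longrightarrow> q \<le> m \<Longrightarrow> q = m"
    by (auto intro: order_trans)
  have add: "m (x + y) = m x + m y" for x y
  proof (rule antisym)
    show "m (x + y) \<le> m x + m y" by (rule sublinear_add[OF m(1)])
    text \<open>The infimum of \<open>m (x + t *\<^sub>R y) - t * m y\<close> over \<open>t \<ge> 0\<close> is sublinear and lies
      below \<open>m\<close>, so it is \<open>m\<close>; now take \<open>t = 1\<close>.\<close>
    let ?D = "{t *\<^sub>R (y, m y) | t. 0 \<le> t}"
    obtain q where q: "sublinear q" "\<And>x v r. (v, r) \<in> ?D \<Longrightarrow> q x \<le> m (x + v) - r"
    proof (rule sublinear_inf_cone[OF m(1), of ?D])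
      show "(0, 0) \<in> ?D" by (auto intro: exI[of _ 0])
    next
      fix z w assume "z \<in> ?D" "w \<in> ?D"
      then obtain s t where "z = s *\<^sub>R (y, m y)" "w = t *\<^sub>R (y, m y)" "0 \<le> s" "0 \<le> t" by blast
      then show "z + w \<in> ?D"
        by (auto intro!: exI[of _ "s + t"] simp: algebra_simps)
    next
      fix c z assume "(0::real) < c" "z \<in> ?D"
      then obtain s where "z = s *\<^sub>R (y, m y)" "0 \<le> s" by blast
      with \<open>0 < c\<close> show "c *\<^sub>R z \<in> ?D"
        by (auto intro!: exI[of _ "c * s"])
    next
      show "r \<le> m v" if "(v, r) \<in> ?D" for v r
        using that by (auto simp: sublinear_scale[OF m(1)])
    qed blast
    have "(0, 0) \<in> ?D" by (auto intro: exI[of _ 0])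
    then have "q x \<le> m x" for x
      using q(2)[of 0 0 x] by simp
    then have "q = m"
      by (intro min q) (simp add: le_fun_def)
    moreover have "(y, m y) \<in> ?D"
      by (auto intro: exI[of _ 1])
    ultimately show "m x + m y \<le> m (x + y)"
      using q(2)[of y "m y" x] by simp
  qed
  have neg: "m (- x) = - m x" for x
    using add[of x "- x"] sublinear_zero[OF m(1)] by simp
  have "linear m"
  proof (rule linearI)
    show "m (x + y) = m x + m y" for x y by (rule add)
    show "m (c *\<^sub>R x) = c *\<^sub>R m x" for c x
      using sublinear_scale[OF m(1), of c x] sublinear_scale[OF m(1), of "- c" x] neg[of "c *\<^sub>R x"]
      by (cases "0 \<le> c") auto
  qed
  then show thesis
    using m(2) by (intro that) (auto simp: le_fun_def)
qed

lemma Hahn_Banach: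
  fixes p f :: "'a::real_vector \<Rightarrow> real"
  assumes p: "sublinear p" and V: "subspace V"
    and f_add: "\<And>x y. x \<in> V \<Longrightarrow> y \<in> V \<Longrightarrow> f (x + y) = f x + f y"
    and f_scale: "\<And>c x. x \<in> V \<Longrightarrow> f (c *\<^sub>R x) = c * f x"
    and le: "\<And>x. x \<in> V \<Longrightarrow> f x \<le> p x"
  obtains g where "linear g" "\<And>x. g x \<le> p x" "\<And>x. x \<in> V \<Longrightarrow> g x = f x"
proof -
  have V0: "0 \<in> V" using V by (rule subspace_0)
  have f0: "f 0 = 0" using f_scale[OF V0, of 0] by simp
  have "\<exists>q. sublinear q \<and> (\<forall>x v r. (v, r) \<in> (\<lambda>v. (v, f v)) ` V \<longrightarrow> q x \<le> p (x + v) - r)"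
    by (rule sublinear_inf_cone[OF p, of "(\<lambda>v. (v, f v)) ` V"])
      (use V0 f0 V f_add f_scale le in \<open>auto intro!: image_eqI intro: subspace_add subspace_scale\<close>)
  then obtain q where q: "sublinear q" "\<And>x v. v \<in> V \<Longrightarrow> q x \<le> p (x + v) - f v"
    by blast
  obtain g where g: "linear g" "\<And>x. g x \<le> q x"
    using linear_minorant_exists[OF q(1)] by blast
  have le_f: "g x \<le> f x" if "x \<in> V" for x
    using order_trans[OF g(2) q(2)[of "- x" x]] that V subspace_neg[OF V that] f_scale[OF that, of "- 1"]
      sublinear_zero[OF p] by simp
  show thesis
  proof (rule that[OF g(1)])
    show "g x \<le> p x" for x
      using order_trans[OF g(2) q(2)[OF V0]] f0 by simp
    show "g x = f x" if "x \<in> V" for x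
      using le_f[OF that] le_f[OF subspace_neg[OF V that]] linear_neg[OF g(1), of x]
        f_scale[OF that, of "- 1"] by simp
  qed
qed

section \<open>Functionals dominated by an upper limit\<close>

lemma le_Limsup_ereal_iff:
  fixes h :: "'a \<Rightarrow> real"
  shows "ereal a \<le> Limsup F (\<lambda>x. ereal (h x)) \<longleftrightarrow> (\<forall>c. (\<forall>\<^sub>F x in F. h x \<le> c) \<longrightarrow> a \<le> c)"
proof (intro iffI allI impI)
  fix c assume "ereal a \<le> Limsup F (\<lambda>x. ereal (h x))" "\<forall>\<^sub>F x in F. h x \<le> c"
  then have "ereal a \<le> ereal c"
    by (elim order_trans, intro Limsup_bounded) simp
  then show "a \<le> c" by simp
next
  assume le: "\<forall>c. (\<forall>\<^sub>F x in F. h x \<le> c) \<longrightarrow> a \<le> c"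
  show "ereal a \<le> Limsup F (\<lambda>x. ereal (h x))"
  proof (rule ccontr)
    assume "\<not> ereal a \<le> Limsup F (\<lambda>x. ereal (h x))"
    then obtain c where c: "Limsup F (\<lambda>x. ereal (h x)) < ereal c" "c < a"
      unfolding not_le using ereal_dense2[of "Limsup F (\<lambda>x. ereal (h x))" "ereal a"] by auto
    have "\<forall>\<^sub>F x in F. h x \<le> c"
      using Limsup_lessD[OF c(1)] by eventually_elim simp
    with le c(2) show False by force
  qed
qed

definition upper_limit :: "'a filter \<Rightarrow> ('a \<Rightarrow> real) \<Rightarrow> real"
  where "upper_limit F h = Inf {c. \<forall>\<^sub>F x in F. h x \<le> c}"

lemma upper_limit_le:
  assumes ne: "F \<noteq> bot" and B: "\<forall>\<^sub>F x in F. \<bar>h x\<bar> \<le> B" and c: "\<forall>\<^sub>F x in F. h x \<le> c"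
  shows "upper_limit F h \<le> c"
  unfolding upper_limit_def
proof (rule cInf_lower)
  show "bdd_below {c. \<forall>\<^sub>F x in F. h x \<le> c}"
  proof (rule bdd_belowI)
    fix d assume "d \<in> {c. \<forall>\<^sub>F x in F. h x \<le> c}"
    then have "\<forall>\<^sub>F x in F. h x \<le> d" by simp
    with B have "\<forall>\<^sub>F x in F. - B \<le> d"
      by eventually_elim linarith
    with ne show "- B \<le> d" by (simp add: eventually_const_iff)
  qed
qed (use c in simp)

lemma upper_limit_ge:
  assumes B: "\<forall>\<^sub>F x in F. \<bar>h x\<bar> \<le> B" and d: "\<And>c. \<forall>\<^sub>F x in F. h x \<le> c \<Longrightarrow> d \<le> c"
  shows "d \<le> upper_limit F h"
proof -
  have "\<forall>\<^sub>F x in F. h x \<le> B" using B by eventually_elim simp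
  then show ?thesis
    unfolding upper_limit_def by (intro cInf_greatest) (auto intro: d)
qed

lemma sublinear_upper_limit:
  fixes h :: "'v::real_vector \<Rightarrow> 'a \<Rightarrow> real"
  assumes ne: "F \<noteq> bot" and B: "\<And>v. \<forall>\<^sub>F x in F. \<bar>h v x\<bar> \<le> B v"
    and lin: "\<And>x. linear (\<lambda>v. h v x)"
  shows "sublinear (\<lambda>v. upper_limit F (h v))"
proof (rule sublinearI)
  fix v w
  have "upper_limit F (h (v + w)) \<le> c + d"
    if "\<forall>\<^sub>F x in F. h v x \<le> c" "\<forall>\<^sub>F x in F. h w x \<le> d" for c d
  proof (rule upper_limit_le[OF ne B])
    show "\<forall>\<^sub>F x in F. h (v + w) x \<le> c + d"
      using that by eventually_elim (simp add: linear_add[OF lin])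
  qed
  then have "upper_limit F (h (v + w)) - d \<le> upper_limit F (h v)"
    if "\<forall>\<^sub>F x in F. h w x \<le> d" for d
    using that by (intro upper_limit_ge[OF B]) (simp add: algebra_simps)
  then have "upper_limit F (h (v + w)) - upper_limit F (h v) \<le> upper_limit F (h w)"
    by (intro upper_limit_ge[OF B]) (simp add: algebra_simps)
  then show "upper_limit F (h (v + w)) \<le> upper_limit F (h v) + upper_limit F (h w)" by simp
next
  fix c v assume c: "(0::real) < c"
  have "upper_limit F (h (c *\<^sub>R v)) / c \<le> upper_limit F (h v)"
  proof (rule upper_limit_ge[OF B])
    fix d assume "\<forall>\<^sub>F x in F. h v x \<le> d"
    then have "\<forall>\<^sub>F x in F. h (c *\<^sub>R v) x \<le> c * d"
      by eventually_elim (use c in \<open>simp add: linear_scale[OF lin]\<close>)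
    then show "upper_limit F (h (c *\<^sub>R v)) / c \<le> d"
      using upper_limit_le[OF ne B] c by (simp add: field_simps)
  qed
  with c show "upper_limit F (h (c *\<^sub>R v)) \<le> c * upper_limit F (h v)"
    by (simp add: field_simps)
next
  show "upper_limit F (h 0) = 0"
  proof (rule antisym)
    show "upper_limit F (h 0) \<le> 0"
      by (rule upper_limit_le[OF ne B]) (simp add: linear_0[OF lin])
    show "0 \<le> upper_limit F (h 0)"
      using ne by (intro upper_limit_ge[OF B]) (simp add: linear_0[OF lin] eventually_const_iff)
  qed
qed

definition average_dominated :: "real filter \<Rightarrow> (linfty \<Rightarrow> real) \<Rightarrow> bool"
  where "average_dominated F \<phi> \<longleftrightarrow> (\<forall>f c. (\<forall>\<^sub>F x in F. average f x \<le> c) \<longrightarrow> \<phi> f \<le> c)"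

lemma average_dominated_mono:
  "average_dominated F \<phi> \<Longrightarrow> F \<le> G \<Longrightarrow> average_dominated G \<phi>"
  unfolding average_dominated_def by (meson filter_leD)

lemma calM_iff: "\<psi> \<in> calM \<longleftrightarrow> average_dominated at_top (blinfun_apply \<psi>)"
  by (simp add: calM_def average_dominated_def le_Limsup_ereal_iff)

lemma average_dominated_blinfun:
  assumes "linear \<phi>" "average_dominated at_top \<phi>"
  obtains \<psi> where "\<psi> \<in> calM" "blinfun_apply \<psi> = \<phi>"
proof -
  have "bounded_linear \<phi>"
    using assms by (intro bounded_linear_if_le_Limsup_average)
      (auto simp: average_dominated_def le_Limsup_ereal_iff)
  then have "blinfun_apply (Blinfun \<phi>) = \<phi>"
    by (rule bounded_linear_Blinfun_apply)
  with assms(2) show thesis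
    by (intro that[of "Blinfun \<phi>"]) (auto simp: calM_iff)
qed

lemma linear_average: "linear (\<lambda>f. average f x)"
  by (rule linearI) (simp_all add: average_add average_scaleR)

lemma eventually_abs_average_le: "F \<le> at_top \<Longrightarrow> \<forall>\<^sub>F x in F. \<bar>average f x\<bar> \<le> norm f"
  by (rule filter_leD[of _ at_top])
    (auto intro: eventually_mono[OF eventually_ge_at_top[of 1]] abs_average_le)

lift_definition unit_linfty :: linfty is "\<lambda>x. 1"
  by (auto simp: linfty_rel_def ess_bounded_def)

lemma average_unit: "1 \<le> x \<Longrightarrow> average unit_linfty x = 1 - 1 / x"
proof transfer
  fix x :: real assume x: "1 \<le> x"
  have "(LINT t:{1..x}|lebesgue. 1) = x - 1"
    unfolding set_lebesgue_integral_leb1 using indicator_integral[OF x] by simp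
  with x show "1 / x * (LINT t:{1..x}|lebesgue. 1) = 1 - 1 / x"
    by (simp add: field_simps)
qed

lemma average_unit_nonneg: "\<forall>\<^sub>F x in at_top. 0 \<le> average unit_linfty x"
  using eventually_ge_at_top[of 1] by eventually_elim (simp add: average_unit)

lemma localized_functional_bound:
  assumes F: "F \<le> at_top" and lin: "linear \<phi>"
    and le: "\<And>f c. \<forall>\<^sub>F x in F. x \<in> A \<longrightarrow> average f x \<le> c \<Longrightarrow> 0 \<le> c \<Longrightarrow> \<phi> f \<le> c"
  shows "0 \<le> \<phi> unit_linfty"
    and "\<forall>\<^sub>F x in F. x \<in> A \<longrightarrow> average f x \<le> c \<Longrightarrow> \<phi> f \<le> c * \<phi> unit_linfty"
proof -
  have "\<forall>\<^sub>F x in F. 0 \<le> average unit_linfty x"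
    using average_unit_nonneg by (rule filter_leD[OF F])
  then have "\<phi> (- unit_linfty) \<le> 0"
    by (intro le) (auto elim!: eventually_mono simp: linear_neg[OF linear_average])
  then show "0 \<le> \<phi> unit_linfty" by (simp add: linear_neg[OF lin])
  assume c: "\<forall>\<^sub>F x in F. x \<in> A \<longrightarrow> average f x \<le> c"
  have "\<phi> (f - c *\<^sub>R unit_linfty) \<le> 0 + e" if e: "0 < e" for e
  proof (rule le)
    have "\<forall>\<^sub>F x in at_top. average unit_linfty x = 1 - 1 / x"
      using eventually_ge_at_top[of 1] by eventually_elim (rule average_unit)
    moreover have "\<forall>\<^sub>F x in at_top. \<bar>c\<bar> / e \<le> x" "\<forall>\<^sub>F x in at_top. 0 < (x::real)"
      by (rule eventually_ge_at_top eventually_gt_at_top)+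
    ultimately have "\<forall>\<^sub>F x in at_top. c - c * average unit_linfty x \<le> e"
    proof eventually_elim
      case (elim x)
      with e have "\<bar>c\<bar> / x \<le> e" by (simp add: field_simps)
      moreover have "c / x \<le> \<bar>c\<bar> / x" using elim by (simp add: divide_right_mono)
      ultimately show ?case unfolding elim by (simp add: algebra_simps)
    qed
    then have "\<forall>\<^sub>F x in F. c - c * average unit_linfty x \<le> e"
      by (rule filter_leD[OF F])
    with c show "\<forall>\<^sub>F x in F. x \<in> A \<longrightarrow> average (f - c *\<^sub>R unit_linfty) x \<le> 0 + e"
      by eventually_elim
        (auto simp: linear_diff[OF linear_average] average_scaleR)
  qed (use e in simp)
  then have "\<phi> (f - c *\<^sub>R unit_linfty) \<le> 0"
    by (rule field_le_epsilon)
  then show "\<phi> f \<le> c * \<phi> unit_linfty"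
    by (simp add: linear_diff[OF lin] linear_scale[OF lin])
qed

lemma average_dominated_unit:
  assumes lin: "linear \<psi>" and dom: "average_dominated F \<psi>" and F: "F \<le> at_top"
  shows "\<psi> unit_linfty = 1"
proof -
  have "\<forall>\<^sub>F x in at_top. average unit_linfty x \<le> 1"
    using eventually_ge_at_top[of 1] by eventually_elim (simp add: average_unit)
  then have "\<forall>\<^sub>F x in F. average unit_linfty x \<le> 1"
    by (rule filter_leD[OF F])
  then have "\<psi> unit_linfty \<le> 1"
    using dom by (simp add: average_dominated_def)
  moreover have "1 \<le> \<psi> unit_linfty"
  proof (rule field_le_epsilon)
    fix e :: real assume e: "0 < e"
    have "\<forall>\<^sub>F x in at_top. 1 / e \<le> x" "\<forall>\<^sub>F x in at_top. 1 \<le> (x::real)"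
      by (rule eventually_ge_at_top)+
    then have "\<forall>\<^sub>F x in at_top. average (- unit_linfty) x \<le> - (1 - e)"
      by eventually_elim
        (use e in \<open>simp add: linear_neg[OF linear_average] average_unit field_simps\<close>)
    then have "\<forall>\<^sub>F x in F. average (- unit_linfty) x \<le> - (1 - e)"
      by (rule filter_leD[OF F])
    with dom have "\<psi> (- unit_linfty) \<le> - (1 - e)"
      unfolding average_dominated_def by blast
    then show "1 \<le> \<psi> unit_linfty + e" by (simp add: linear_neg[OF lin])
  qed
  ultimately show ?thesis by simp
qed

text \<open>The upper limit of the function that is \<open>average f\<close> on \<open>A\<close> and \<open>average g\<close> off \<open>A\<close> is
  sublinear in \<open>(f, g)\<close>. Hahn--Banach extends \<open>\<psi>\<close> from the diagonal, and \<open>\<phi>\<^sub>1\<close>, \<open>\<phi>\<^sub>2\<close> are the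
  two components of the extension.\<close>

lemma average_dominated_decomposition:
  assumes F: "F \<le> at_top" "F \<noteq> bot" and lin: "linear \<psi>" and dom: "average_dominated F \<psi>"
  obtains \<phi>\<^sub>1 \<phi>\<^sub>2 where "linear \<phi>\<^sub>1" "linear \<phi>\<^sub>2" "\<And>f. \<psi> f = \<phi>\<^sub>1 f + \<phi>\<^sub>2 f"
    "\<And>f c. \<forall>\<^sub>F x in F. x \<in> A \<longrightarrow> average f x \<le> c \<Longrightarrow> \<phi>\<^sub>1 f \<le> c * \<phi>\<^sub>1 unit_linfty"
    "\<And>f c. \<forall>\<^sub>F x in F. x \<in> - A \<longrightarrow> average f x \<le> c \<Longrightarrow> \<phi>\<^sub>2 f \<le> c * \<phi>\<^sub>2 unit_linfty"
    "0 \<le> \<phi>\<^sub>1 unit_linfty" "0 \<le> \<phi>\<^sub>2 unit_linfty"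
proof -
  define h :: "linfty \<times> linfty \<Rightarrow> real \<Rightarrow> real"
    where "h v x = (if x \<in> A then average (fst v) x else average (snd v) x)" for v x
  let ?P = "\<lambda>v. upper_limit F (h v)"
  have B: "\<forall>\<^sub>F x in F. \<bar>h v x\<bar> \<le> norm (fst v) + norm (snd v)" for v
    using eventually_abs_average_le[OF F(1), of "fst v"] eventually_abs_average_le[OF F(1), of "snd v"]
  proof eventually_elim
    case (elim x)
    then show ?case
      using norm_ge_zero[of "fst v"] norm_ge_zero[of "snd v"] unfolding h_def by (smt (verit))
  qed
  have hlin: "linear (\<lambda>v. h v x)" for x
    by (rule linearI) (auto simp: h_def average_add average_scaleR)
  have P: "sublinear ?P"
    by (rule sublinear_upper_limit[OF F(2) B hlin])
  obtain \<xi> where \<xi>: "linear \<xi>" "\<And>v. \<xi> v \<le> ?P v"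
    and diag: "\<And>v. v \<in> range (\<lambda>f. (f, f)) \<Longrightarrow> \<xi> v = \<psi> (fst v)"
  proof (rule Hahn_Banach[OF P, of "range (\<lambda>f. (f, f))" "\<lambda>v. \<psi> (fst v)"])
    show "subspace (range (\<lambda>f::linfty. (f, f)))"
      by (auto simp: subspace_def zero_prod_def)
    show "\<psi> (fst v) \<le> ?P v" if "v \<in> range (\<lambda>f. (f, f))" for v
      using dom that by (intro upper_limit_ge[OF B])
        (auto simp: h_def average_dominated_def cong: if_cong)
  qed (auto simp: linear_add[OF lin] linear_scale[OF lin])
  have \<xi>_le: "\<xi> v \<le> c" if "\<forall>\<^sub>F x in F. h v x \<le> c" for v c
    using \<xi>(2) upper_limit_le[OF F(2) B that] by (rule order_trans)
  define \<phi>\<^sub>1 \<phi>\<^sub>2 where "\<phi>\<^sub>1 f = \<xi> (f, 0)" and "\<phi>\<^sub>2 f = \<xi> (0, f)" for f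
  have lin1: "linear \<phi>\<^sub>1" and lin2: "linear \<phi>\<^sub>2"
    unfolding \<phi>\<^sub>1_def \<phi>\<^sub>2_def
    by (auto intro!: linearI simp flip: linear_add[OF \<xi>(1)] linear_scale[OF \<xi>(1)] simp del: real_scaleR_def)
  have le1: "\<phi>\<^sub>1 f \<le> c" if "\<forall>\<^sub>F x in F. x \<in> A \<longrightarrow> average f x \<le> c" "0 \<le> c" for f c
    unfolding \<phi>\<^sub>1_def using that
    by (intro \<xi>_le) (auto simp: h_def linear_0[OF linear_average] elim: eventually_mono)
  have le2: "\<phi>\<^sub>2 f \<le> c" if "\<forall>\<^sub>F x in F. x \<in> - A \<longrightarrow> average f x \<le> c" "0 \<le> c" for f c
    unfolding \<phi>\<^sub>2_def using that
    by (intro \<xi>_le) (auto simp: h_def linear_0[OF linear_average] elim: eventually_mono)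
  show thesis
  proof (rule that[OF lin1 lin2])
    show "\<psi> f = \<phi>\<^sub>1 f + \<phi>\<^sub>2 f" for f
      using diag[of "(f, f)"] linear_add[OF \<xi>(1), of "(f, 0)" "(0, f)"] by (simp add: \<phi>\<^sub>1_def \<phi>\<^sub>2_def)
  qed (use localized_functional_bound[OF F(1) lin1 le1] localized_functional_bound[OF F(1) lin2 le2]
      in blast)+
qed

lemma extreme_point_average_dominated_split:
  assumes ext: "\<psi> extreme_point_of calM" and F: "F \<le> at_top" "F \<noteq> bot"
    and dom: "average_dominated F (blinfun_apply \<psi>)"
  shows "average_dominated (inf F (principal A)) (blinfun_apply \<psi>) \<or>
    average_dominated (inf F (principal (- A))) (blinfun_apply \<psi>)"
proof -
  have lin: "linear (blinfun_apply \<psi>)"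
    by (simp add: blinfun.bounded_linear_right bounded_linear.linear)
  obtain \<phi>\<^sub>1 \<phi>\<^sub>2 where lin12: "linear \<phi>\<^sub>1" "linear \<phi>\<^sub>2"
    and sum: "\<And>f. \<psi> f = \<phi>\<^sub>1 f + \<phi>\<^sub>2 f"
    and le1: "\<And>f c. \<forall>\<^sub>F x in F. x \<in> A \<longrightarrow> average f x \<le> c \<Longrightarrow> \<phi>\<^sub>1 f \<le> c * \<phi>\<^sub>1 unit_linfty"
    and le2: "\<And>f c. \<forall>\<^sub>F x in F. x \<in> - A \<longrightarrow> average f x \<le> c \<Longrightarrow> \<phi>\<^sub>2 f \<le> c * \<phi>\<^sub>2 unit_linfty"
    and nonneg: "0 \<le> \<phi>\<^sub>1 unit_linfty" "0 \<le> \<phi>\<^sub>2 unit_linfty"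
    using average_dominated_decomposition[OF F lin dom] by blast
  let ?a = "\<phi>\<^sub>1 unit_linfty" and ?b = "\<phi>\<^sub>2 unit_linfty"
  have ab: "?a + ?b = 1"
    using sum[of unit_linfty] average_dominated_unit[OF lin dom F(1)] by simp
  have vanish: "\<phi> f = 0"
    if "linear \<phi>" "\<phi> unit_linfty = 0"
      and le: "\<And>f c. \<forall>\<^sub>F x in F. x \<in> E \<longrightarrow> average f x \<le> c \<Longrightarrow> \<phi> f \<le> c * \<phi> unit_linfty"
    for \<phi> :: "linfty \<Rightarrow> real" and f E
  proof -
    have "\<phi> f \<le> 0" for f
    proof -
      have "\<forall>\<^sub>F x in F. x \<in> E \<longrightarrow> average f x \<le> norm f"
        using eventually_abs_average_le[OF F(1), of f] by eventually_elim linarith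
      then show ?thesis using le[of f "norm f"] that(2) by simp
    qed
    from this[of f] this[of "- f"] show ?thesis by (simp add: linear_neg[OF that(1)])
  qed
  consider "?a = 0" | "?b = 0" | "0 < ?a" "0 < ?b"
    using nonneg by linarith
  then show ?thesis
  proof cases
    case 1
    then have "\<phi>\<^sub>1 f = 0" for f
      by (rule vanish[OF lin12(1) _ le1])
    then show ?thesis
      using le2 1 ab sum by (simp add: average_dominated_def eventually_inf_principal)
  next
    case 2
    then have "\<phi>\<^sub>2 f = 0" for f
      by (rule vanish[OF lin12(2) _ le2])
    then show ?thesis
      using le1 2 ab sum by (simp add: average_dominated_def eventually_inf_principal)
  next
    case 3
    have dom1: "average_dominated (inf F (principal A)) (\<lambda>f. \<phi>\<^sub>1 f / ?a)"
      using le1 3 by (simp add: average_dominated_def eventually_inf_principal field_simps)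
    have dom2: "average_dominated (inf F (principal (- A))) (\<lambda>f. \<phi>\<^sub>2 f / ?b)"
      using le2 3 by (simp add: average_dominated_def eventually_inf_principal field_simps)
    have top: "inf F G \<le> at_top" for G
      using F(1) by (rule le_infI1)
    have "linear (\<lambda>f. \<phi>\<^sub>1 f / ?a)" "linear (\<lambda>f. \<phi>\<^sub>2 f / ?b)"
      using lin12 by (auto simp: linear_iff add_divide_distrib)
    then obtain \<psi>\<^sub>1 \<psi>\<^sub>2 where M: "\<psi>\<^sub>1 \<in> calM" "\<psi>\<^sub>2 \<in> calM"
      and \<psi>12: "blinfun_apply \<psi>\<^sub>1 = (\<lambda>f. \<phi>\<^sub>1 f / ?a)" "blinfun_apply \<psi>\<^sub>2 = (\<lambda>f. \<phi>\<^sub>2 f / ?b)"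
      using average_dominated_blinfun average_dominated_mono[OF dom1 top]
        average_dominated_mono[OF dom2 top] by metis
    have comb: "\<psi> = (1 - ?b) *\<^sub>R \<psi>\<^sub>1 + ?b *\<^sub>R \<psi>\<^sub>2"
      using 3 ab sum by (intro blinfun_eqI)
        (simp add: plus_blinfun.rep_eq scaleR_blinfun.rep_eq \<psi>12 eq_diff_eq[symmetric])
    have "\<psi>\<^sub>1 = \<psi>\<^sub>2"
    proof (rule ccontr)
      assume "\<psi>\<^sub>1 \<noteq> \<psi>\<^sub>2"
      then have "\<psi> \<in> open_segment \<psi>\<^sub>1 \<psi>\<^sub>2"
        unfolding in_segment using comb 3 ab by (intro conjI exI[of _ ?b]) auto
      with ext M show False by (auto simp: extreme_point_of_def)
    qed
    then have "\<psi> = \<psi>\<^sub>1"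
      unfolding comb by (simp add: algebra_simps flip: scaleR_add_left)
    with dom1 \<psi>12 show ?thesis by simp
  qed
qed

section \<open>Ultrafilters as minimal filters\<close>

lemma eventually_Inf_chain:
  assumes "C \<noteq> {}" and chain: "\<And>F G. F \<in> C \<Longrightarrow> G \<in> C \<Longrightarrow> F \<le> G \<or> G \<le> F"
  shows "eventually P (Inf C) \<longleftrightarrow> (\<exists>F\<in>C. eventually P F)"
proof (rule eventually_Inf_base[OF assms(1)])
  show "\<exists>H\<in>C. H \<le> inf F G" if "F \<in> C" "G \<in> C" for F G
    using chain[OF that] that by (auto intro: bexI[of _ F] bexI[of _ G])
qed

lemma minimal_filter_exists:
  fixes G :: "'a filter"
  assumes G: "Q G"
    and chain: "\<And>C. C \<noteq> {} \<Longrightarrow> (\<And>F. F \<in> C \<Longrightarrow> Q F) \<Longrightarrow>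
      (\<And>P. eventually P (Inf C) \<longleftrightarrow> (\<exists>F\<in>C. eventually P F)) \<Longrightarrow> Q (Inf C)"
  obtains U where "Q U" "U \<le> G" "\<And>F. Q F \<Longrightarrow> F \<le> U \<Longrightarrow> F = U"
proof -
  let ?S = "{F. Q F \<and> F \<le> G}"
  have "\<exists>U\<in>?S. \<forall>F\<in>?S. F \<le> U \<longrightarrow> F = U"
  proof (rule minimal_element_exists)
    fix C assume C: "C \<subseteq> ?S" and ch: "\<And>F H. F \<in> C \<Longrightarrow> H \<in> C \<Longrightarrow> F \<le> H \<or> H \<le> F"
    show "\<exists>U\<in>?S. \<forall>F\<in>C. U \<le> F"
    proof (cases "C = {}")
      case False
      have "Q (Inf C)"
        using C by (intro chain[OF False] eventually_Inf_chain[OF False ch]) auto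
      moreover have "Inf C \<le> G"
        using C False by (auto intro: Inf_lower2)
      ultimately show ?thesis by (auto intro: Inf_lower)
    qed (use G in auto)
  qed
  then show thesis by (auto intro: that order_trans)
qed

lemma free_ultrafilterI:
  assumes ne: "U \<noteq> bot" and top: "U \<le> at_top"
    and ultra: "\<And>A. (\<forall>\<^sub>F x in U. x \<in> A) \<or> (\<forall>\<^sub>F x in U. x \<in> - A)"
  shows "ultrafilter_on {1..} U" "free_at_infinity U"
proof -
  have ev: "\<forall>\<^sub>F x in U. x \<in> {1..}"
    using filter_leD[OF top eventually_ge_at_top[of 1]] by simp
  have "(\<forall>\<^sub>F x in U. x \<in> A) \<or> (\<forall>\<^sub>F x in U. x \<in> {1..} - A)" for A
    using ultra[of A] eventually_conj[OF ev, of "\<lambda>x. x \<in> - A"] by auto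
  with ne ev show "ultrafilter_on {1..} U"
    unfolding ultrafilter_on_def by blast
  show "free_at_infinity U"
    unfolding free_at_infinity_def
  proof (intro allI impI notI)
    fix A assume "bounded A" and A: "\<forall>\<^sub>F x in U. x \<in> A"
    then obtain b where b: "\<And>x. x \<in> A \<Longrightarrow> \<bar>x\<bar> \<le> b"
      by (auto simp: bounded_iff)
    from A filter_leD[OF top eventually_gt_at_top[of b]] have "\<forall>\<^sub>F x in U. False"
      by eventually_elim (use b in force)
    with ne show False by (simp add: trivial_limit_def)
  qed
qed

lemma free_ultrafilter_le_at_top:
  assumes "ultrafilter_on {1..} U" "free_at_infinity U"
  shows "U \<le> at_top"
proof -
  have "\<forall>\<^sub>F x in U. N \<le> x" for N
  proof -
    have sub: "{1..<N} \<subseteq> {1..}" by auto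
    moreover have "bounded {1..<N}" by simp
    ultimately have "\<not> (\<forall>\<^sub>F x in U. x \<in> {1..<N})"
      using assms(2) unfolding free_at_infinity_def by blast
    with sub have "\<forall>\<^sub>F x in U. x \<in> {1..} - {1..<N}"
      using assms(1) unfolding ultrafilter_on_def by blast
    then show ?thesis by eventually_elim auto
  qed
  then have "filterlim (\<lambda>x. x) at_top U" by (simp add: filterlim_at_top)
  then show ?thesis by (simp add: filterlim_def filtermap_ident)
qed

lemma free_ultrafilter_exists:
  fixes G :: "real filter"
  assumes "G \<noteq> bot" "G \<le> at_top"
  obtains U where "U \<le> G" "ultrafilter_on {1..} U" "free_at_infinity U"
proof -
  obtain U where U: "U \<noteq> bot" "U \<le> G" and min: "\<And>F. F \<noteq> bot \<Longrightarrow> F \<le> U \<Longrightarrow> F = U"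
  proof (rule minimal_filter_exists[of "\<lambda>F. F \<noteq> bot" G])
    show "G \<noteq> bot" by fact
    show "Inf C \<noteq> bot"
      if "\<And>F. F \<in> C \<Longrightarrow> F \<noteq> bot" "\<And>P. eventually P (Inf C) \<longleftrightarrow> (\<exists>F\<in>C. eventually P F)"
      for C :: "real filter set"
      using that unfolding trivial_limit_def by blast
  qed blast
  have "(\<forall>\<^sub>F x in U. x \<in> A) \<or> (\<forall>\<^sub>F x in U. x \<in> - A)" for A
  proof (cases "inf U (principal A) = bot")
    case True
    then have "\<forall>\<^sub>F x in U. x \<in> - A"
      by (simp add: trivial_limit_def eventually_inf_principal)
    then show ?thesis ..
  next
    case False
    then have "inf U (principal A) = U" by (rule min) simp
    then have "U \<le> principal A" by (simp add: inf.absorb_iff1)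
    then show ?thesis by (simp add: le_principal)
  qed
  with U assms(2) show thesis
    by (intro that[OF U(2)] free_ultrafilterI) auto
qed

section \<open>Extreme points\<close>

lemma average_dominated_ultrafilter_limit:
  assumes lin: "linear \<phi>" and dom: "average_dominated U \<phi>" and U: "ultrafilter_on {1..} U"
  shows "(average f \<longlongrightarrow> \<phi> f) U"
proof -
  have "\<exists>l. (average f \<longlongrightarrow> l) U" for f
    using U by (rule ultrafilter_limit_exists[where C = "norm f"]) (simp add: abs_average_le)
  then obtain l where l: "\<And>f. (average f \<longlongrightarrow> l f) U" by metis
  have le: "\<phi> f \<le> l f" for f
  proof (rule field_le_epsilon)
    fix e :: real assume "0 < e"
    then have "\<forall>\<^sub>F x in U. average f x < l f + e"
      by (intro order_tendstoD(2)[OF l]) simp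
    then have "\<forall>\<^sub>F x in U. average f x \<le> l f + e"
      by eventually_elim simp
    with dom show "\<phi> f \<le> l f + e" by (simp add: average_dominated_def)
  qed
  have "average (- f) = (\<lambda>x. - average f x)"
    by (simp add: fun_eq_iff linear_neg[OF linear_average])
  then have "(average (- f) \<longlongrightarrow> - l f) U"
    using tendsto_minus[OF l[of f]] by (simp only:)
  then have "l (- f) = - l f"
    using l U tendsto_unique unfolding ultrafilter_on_def by blast
  with le[of f] le[of "- f"] have "\<phi> f = l f"
    by (simp add: linear_neg[OF lin])
  with l show ?thesis by simp
qed

lemma extreme_point_in_calM_tilde:
  assumes ext: "\<psi> extreme_point_of calM"
  shows "\<psi> \<in> calM_tilde"
proof -
  let ?Q = "\<lambda>F. average_dominated F (blinfun_apply \<psi>)"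
  have ne: "F \<noteq> bot" if "?Q F" for F
  proof
    assume "F = bot"
    then have "\<forall>\<^sub>F x in F. average 0 x \<le> - 1" by simp
    with that have "\<psi> 0 \<le> - 1" unfolding average_dominated_def by blast
    then show False by simp
  qed
  have "?Q at_top"
    using ext calM_iff by (auto simp: extreme_point_of_def)
  then obtain U where U: "?Q U" "U \<le> at_top" and min: "\<And>F. ?Q F \<Longrightarrow> F \<le> U \<Longrightarrow> F = U"
    by (rule minimal_filter_exists[of ?Q]) (auto simp: average_dominated_def)
  have "(\<forall>\<^sub>F x in U. x \<in> A) \<or> (\<forall>\<^sub>F x in U. x \<in> - A)" for A
  proof -
    have "inf U (principal A) = U \<or> inf U (principal (- A)) = U"
      using extreme_point_average_dominated_split[OF ext U(2) ne[OF U(1)] U(1), of A]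
      by (auto intro: min)
    then show ?thesis by (simp add: le_principal flip: inf.absorb_iff1)
  qed
  then have ultra: "ultrafilter_on {1..} U" "free_at_infinity U"
    by (intro free_ultrafilterI ne U; assumption)+
  have "linear (blinfun_apply \<psi>)"
    by (simp add: blinfun.bounded_linear_right bounded_linear.linear)
  with ultra U(1) show ?thesis
    by (auto simp: calM_tilde_def intro: average_dominated_ultrafilter_limit)
qed

section \<open>Compactness\<close>

lemma tendsto_fun_iff:
  fixes h :: "'a \<Rightarrow> 'i \<Rightarrow> 'b::topological_space"
  shows "(h \<longlongrightarrow> l) F \<longleftrightarrow> (\<forall>i. ((\<lambda>x. h x i) \<longlongrightarrow> l i) F)"
  using limitin_componentwise[of "\<lambda>_. euclidean" UNIV h l F]
  by (simp add: euclidean_product_topology)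

lemma compactin_strong_operator_topology:
  fixes S :: "('a::real_normed_vector \<Rightarrow>\<^sub>L 'b::real_normed_vector) set"
  assumes S: "compact (blinfun_apply ` S)"
  shows "compactin strong_operator_topology S"
  unfolding compactin_def
proof (intro conjI allI impI)
  show "S \<subseteq> topspace strong_operator_topology"
    by (simp add: strong_operator_topology_topspace)
  fix \<U> assume \<U>: "(\<forall>W\<in>\<U>. openin strong_operator_topology W) \<and> S \<subseteq> \<Union>\<U>"
  then have "\<forall>W\<in>\<U>. \<exists>V. open V \<and> W = blinfun_apply -` V"
    by (simp add: strong_operator_topology_def openin_pullback_topology)
  then obtain V where V: "\<And>W. W \<in> \<U> \<Longrightarrow> open (V W)" "\<And>W. W \<in> \<U> \<Longrightarrow> W = blinfun_apply -` V W"
    by metis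
  have "blinfun_apply ` S \<subseteq> (\<Union>W\<in>\<U>. V W)"
    using \<U> V(2) by blast
  then obtain \<F> where "\<F> \<subseteq> \<U>" "finite \<F>" "blinfun_apply ` S \<subseteq> (\<Union>W\<in>\<F>. V W)"
    using compactE_image[OF S, of \<U> V] V(1) by metis
  moreover from this have "S \<subseteq> \<Union>\<F>"
    using V(2) by blast
  ultimately show "\<exists>\<F>. finite \<F> \<and> \<F> \<subseteq> \<U> \<and> S \<subseteq> \<Union>\<F>" by blast
qed

lemma blinfun_apply_calM_tilde:
  "blinfun_apply ` calM_tilde = (\<Inter>N. closure ((\<lambda>x f. average f x) ` {N..}))"
proof (intro equalityI subsetI)
  fix p assume "p \<in> blinfun_apply ` calM_tilde"
  then obtain U where U: "ultrafilter_on {1..} U" "free_at_infinity U" and p: "\<And>f. (average f \<longlongrightarrow> p f) U"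
    by (auto simp: calM_tilde_def)
  have lim: "((\<lambda>x f. average f x) \<longlongrightarrow> p) U"
    using p by (simp add: tendsto_fun_iff)
  have ne: "U \<noteq> bot" using U(1) by (simp add: ultrafilter_on_def)
  have "p \<in> closure ((\<lambda>x f. average f x) ` {N..})" for N
    unfolding closure_iff_nhds_not_empty
  proof (intro allI impI)
    fix A S assume S: "S \<subseteq> A" "open S" "p \<in> S"
    have "\<forall>\<^sub>F x in U. N \<le> x \<and> (\<lambda>f. average f x) \<in> S"
      using filter_leD[OF free_ultrafilter_le_at_top[OF U] eventually_ge_at_top[of N]]
        topological_tendstoD[OF lim S(2,3)] by (rule eventually_conj)
    then obtain x where "N \<le> x" "(\<lambda>f. average f x) \<in> S"
      using eventually_happens ne by blast
    with S(1) show "(\<lambda>x f. average f x) ` {N..} \<inter> A \<noteq> {}" by auto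
  qed
  then show "p \<in> (\<Inter>N. closure ((\<lambda>x f. average f x) ` {N..}))" by blast
next
  fix p assume p: "p \<in> (\<Inter>N. closure ((\<lambda>x f. average f x) ` {N..}))"
  let ?G = "inf (filtercomap (\<lambda>x f. average f x) (nhds p)) at_top"
  have "?G \<noteq> bot"
  proof
    assume "?G = bot"
    then have "\<forall>\<^sub>F x in ?G. False" by simp
    then obtain P Q where PQ: "eventually P (filtercomap (\<lambda>x f. average f x) (nhds p))"
      "eventually Q at_top" "\<And>x. P x \<Longrightarrow> Q x \<Longrightarrow> False"
      unfolding eventually_inf by blast
    obtain R where "eventually R (nhds p)" and R: "\<And>x. R (\<lambda>f. average f x) \<Longrightarrow> P x"
      using PQ(1) by (auto simp: eventually_filtercomap)
    then obtain S where S: "open S" "p \<in> S" "\<And>q. q \<in> S \<Longrightarrow> R q"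
      by (auto simp: eventually_nhds)
    obtain N where N: "\<And>x. N \<le> x \<Longrightarrow> Q x"
      using PQ(2) by (auto simp: eventually_at_top_linorder)
    have "p \<in> closure ((\<lambda>x f. average f x) ` {N..})"
      using p by (rule INT_D) simp
    then have "(\<lambda>x f. average f x) ` {N..} \<inter> S \<noteq> {}"
      unfolding closure_iff_nhds_not_empty using S(1,2) by (elim allE[of _ S]) simp
    with S(3) R N PQ(3) show False by auto
  qed
  then obtain U where U: "U \<le> ?G" "ultrafilter_on {1..} U" "free_at_infinity U"
    by (rule free_ultrafilter_exists) auto
  have "((\<lambda>x f. average f x) \<longlongrightarrow> p) U"
    using U(1) by (simp add: filterlim_iff_le_filtercomap)
  then have lim: "(average f \<longlongrightarrow> p f) U" for f
    by (simp add: tendsto_fun_iff)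
  obtain \<psi> where \<psi>: "\<And>f. (average f \<longlongrightarrow> blinfun_apply \<psi> f) U"
    using ultrafilter_functional_exists[OF U(2)] by blast
  have "p = blinfun_apply \<psi>"
    using \<psi> lim U(2) tendsto_unique unfolding ultrafilter_on_def by blast
  with \<psi> U show "p \<in> blinfun_apply ` calM_tilde"
    by (auto simp: calM_tilde_def)
qed

lemma compactin_calM_tilde: "compactin weak_star_topology calM_tilde"
proof (rule compactin_strong_operator_topology)
  let ?B = "Pi\<^sub>E UNIV (\<lambda>f::linfty. {- norm f..norm f})"
  let ?K = "\<Inter>N. closure ((\<lambda>x f. average f x) ` {N::real..})"
  have B: "compact ?B"
    using compactin_PiE[of "\<lambda>_. euclidean" UNIV "\<lambda>f::linfty. {- norm f..norm f}"]
    by (simp add: euclidean_product_topology)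
  have "?K \<subseteq> closure ((\<lambda>x f. average f x) ` {1..})" by blast
  also have "\<dots> \<subseteq> ?B"
  proof (rule closure_minimal)
    show "(\<lambda>x f. average f x) ` {1..} \<subseteq> ?B"
      using abs_average_le by (auto simp: PiE_iff abs_le_iff minus_le_iff)
    show "closed ?B"
      using closedin_product_topology[of "\<lambda>_. euclidean" UNIV "\<lambda>f::linfty. {- norm f..norm f}"]
      by (simp add: euclidean_product_topology)
  qed
  finally have "?K = ?B \<inter> ?K" by blast
  moreover have "compact (?B \<inter> ?K)"
    by (intro compact_Int_closed B closed_INT ballI closed_closure)
  ultimately show "compact (blinfun_apply ` calM_tilde)"
    by (simp only: blinfun_apply_calM_tilde)
qed

theorem theorem4p1:
  shows "compactin weak_star_topology calM_tilde \<and> {\<psi>. \<psi> extreme_point_of calM} \<subseteq> calM_tilde"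
  using compactin_calM_tilde extreme_point_in_calM_tilde by blast

end
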